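(* Let $1\le p<n$ be integers and let $(x_1,y_1),\dots,(x_n,y_n)$ be i.i.d. copies of a random pair $(x,y)$ in $\mathbb{R}^p\times\{-1,+1\}$ with $x\sim\mathcal{N}(0,I_p)$. Suppose that for some $\beta^*\in S^{p-1}$ the label $y$ depends on $x$ only through $x^T\beta^*$, i.e. $\mathbb{P}[y=1\mid x]=\mathbb{P}[y=1\mid x^T\beta^*]$. Suppose that for some $t\ge 0$, $$ \frac{2(p-1)}{n}+\left(4+\frac{1}{\sqrt2}\right)\sqrt{\frac{t}{n}}\le\mathbb{P}[yx^T\beta^*<0]\le\frac12 . $$ Then the probability of linear separability without intercept satisfies $$S(n,p)\le 3\exp(-t).$$
   Context: $S^{p-1}:=\{\beta\in\mathbb{R}^p:\|\beta\|_2=1\}$. The probability of linear separability without intercept is $S(n,p):=\mathbb{P}\big[\bigcup_{\beta\in\mathbb{R}^p}\bigcap_{j=1}^n\{y_jx_j^T\beta>0\}\big]$. *)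

theory Defs
  imports "HOL-Probability.Probability"
begin

definition std_normal_vec_density :: "real ^ 'p \<Rightarrow> real" where
  "std_normal_vec_density v = 1 / sqrt ((2 * pi) ^ CARD('p)) * exp (- (norm v)\<^sup>2 / 2)"

lemma std_normal_vec_density_eq_prod:
  fixes v :: "real ^ 'p"
  shows "std_normal_vec_density v = (\<Prod>i\<in>UNIV. std_normal_density (v $ i))"
proof -
  have "(norm v)\<^sup>2 = (\<Sum>i\<in>UNIV. (v $ i)\<^sup>2)"
    by (simp add: norm_vec_def L2_set_def sum_nonneg)
  then have "exp (- (norm v)\<^sup>2 / 2) = (\<Prod>i\<in>UNIV. exp (- (v $ i)\<^sup>2 / 2))"
    by (simp add: exp_sum [symmetric] sum_negf sum_divide_distrib)
  then show ?thesis
    unfolding std_normal_vec_density_def std_normal_density_def prod.distrib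
    by (simp only: real_sqrt_power prod_constant power_one_over)
qed

text \<open>The sample space of a labelled observation in \<open>\<real>\<^sup>p \<times> {-1,+1}\<close>.\<close>

definition obs_space :: "((real ^ 'p) \<times> real) measure" where
  "obs_space = borel \<Otimes>\<^sub>M count_space {-1, 1}"

text \<open>A version of the conditional probability of the event \<open>E\<close> given the random variable
  \<open>Z\<close>; it is determined only
  almost everywhere, and is meaningful only if \<open>E\<close> and \<open>Z\<close> are measurable.\<close>

definition cond_prob_given ::
    "'a measure \<Rightarrow> ('a \<Rightarrow> bool) \<Rightarrow> ('a \<Rightarrow> 'b::topological_space) \<Rightarrow> 'a \<Rightarrow> real" where
  "cond_prob_given M E Z =
     real_cond_exp M (vimage_algebra (space M) Z borel) (indicator {\<omega> \<in> space M. E \<omega>})"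

text \<open>Only the observations with indices \<open>1,\<dots>,n\<close> are used; the dimension is the
  cardinality of the index type of the feature vectors.\<close>

definition separability_prob ::
    "'a measure \<Rightarrow> (nat \<Rightarrow> 'a \<Rightarrow> real ^ 'p) \<Rightarrow> (nat \<Rightarrow> 'a \<Rightarrow> real) \<Rightarrow> nat \<Rightarrow> real" where
  "separability_prob M X Y n =
     measure M (\<Union>\<beta>. {\<omega> \<in> space M. \<forall>j\<in>{1..n}. Y j \<omega> * (X j \<omega> \<bullet> \<beta>) > 0})"

end

theory Submission
  imports Defs
begin

text \<open>
  Let \<open>W\<^sub>j = y\<^sub>j x\<^sub>j\<^sup>T\<beta>\<^sup>*\<close> and let \<open>u\<^sub>j\<close> be the projection of \<open>y\<^sub>j x\<^sub>j\<close> to \<open>T = (\<beta>\<^sup>*)\<^sup>\<bottom>\<close>, so that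
  \<open>y\<^sub>j x\<^sub>j\<^sup>T\<beta> = c W\<^sub>j + u\<^sub>j\<^sup>Tw\<close> for \<open>\<beta> = c \<beta>\<^sup>* + w\<close> with \<open>w \<in> T\<close>. If \<open>\<beta>\<close> separates the sample and
  \<open>c \<ge> 0\<close>, then \<open>u\<^sub>j\<^sup>Tw > 0\<close> whenever \<open>W\<^sub>j < 0\<close>; if \<open>c \<le> 0\<close>, the same holds whenever \<open>W\<^sub>j \<ge> 0\<close>.
  By Hoeffding's inequality, both index sets have more than \<open>2(p-1) + 4\<surd>(nt)\<close> elements, except
  with probability \<open>2e\<^sup>-\<^sup>t\<close>. The law of an observation is invariant under the reflection of \<open>x\<close> that
  fixes \<open>\<beta>\<^sup>*\<close> and negates \<open>T\<close>, hence the signs of the \<open>u\<^sub>j\<close> may be flipped independently. Cover's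
  counting argument bounds the number of sign patterns of \<open>m\<close> vectors that a functional in \<open>T\<close> can
  realize by \<open>\<Sum>i\<le>p-1. (m choose i)\<close>, and the binomial tail bound shows that each of the two
  index sets admits a separating \<open>w\<close> with probability at most \<open>e\<^sup>-\<^sup>8\<^sup>t\<close>. The resulting total
  \<open>2e\<^sup>-\<^sup>t + 2e\<^sup>-\<^sup>8\<^sup>t\<close> is at most \<open>3e\<^sup>-\<^sup>t\<close> unless that bound exceeds \<open>1\<close>.
\<close>

section \<open>Sign patterns and the binomial tail\<close>

text \<open>When an index \<open>j\<close> is added, a pattern on \<open>J\<close> extends in both
  ways only if it is realized by some functional in \<open>S\<close> orthogonal to
  \<open>u j\<close>. These functionals form a subspace \<open>T\<close> of smaller dimension, so
  the count for \<open>insert j J\<close> in \<open>S\<close> is at most the sum of the counts for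
  \<open>J\<close> in \<open>S\<close> and in \<open>T\<close>, which matches Pascal's rule.\<close>

lemma card_linear_dichotomies_le:
  fixes u :: "'i \<Rightarrow> 'a::euclidean_space"
  assumes "finite J" "subspace S"
  shows "card {K. K \<subseteq> J \<and> (\<exists>\<beta>\<in>S. (\<forall>j\<in>K. u j \<bullet> \<beta> > 0) \<and> (\<forall>j\<in>J - K. u j \<bullet> \<beta> < 0))}
           \<le> (\<Sum>i\<le>dim S. card J choose i)"
  using assms
proof (induction J arbitrary: S rule: finite_induct)
  case empty
  have "{K. K \<subseteq> {} \<and> (\<exists>\<beta>\<in>S. (\<forall>j\<in>K. u j \<bullet> \<beta> > 0) \<and> (\<forall>j\<in>{} - K. u j \<bullet> \<beta> < 0))} \<subseteq> {{}}"
    by auto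
  then have "card {K. K \<subseteq> {} \<and> (\<exists>\<beta>\<in>S. (\<forall>j\<in>K. u j \<bullet> \<beta> > 0) \<and> (\<forall>j\<in>{} - K. u j \<bullet> \<beta> < 0))} \<le> card {{} :: 'i set}"
    by (intro card_mono) auto
  also have "\<dots> \<le> (\<Sum>i\<le>dim S. card ({} :: 'i set) choose i)"
    using member_le_sum[of 0 "{..dim S}" "\<lambda>i. 0 choose i"] by simp
  finally show ?case .
next
  case (insert j J)
  define P where "P J S = {K. K \<subseteq> J \<and> (\<exists>\<beta>\<in>S. (\<forall>j\<in>K. u j \<bullet> \<beta> > 0) \<and> (\<forall>j\<in>J - K. u j \<bullet> \<beta> < 0))}" 
    for J S
  have fin: "finite (P J S)" for S
    using insert.hyps by (auto simp: P_def)
  have finj: "finite (P (insert j J) S)" for S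
    using insert.hyps by (auto simp: P_def)
  show ?case
  proof (cases "\<forall>\<beta>\<in>S. u j \<bullet> \<beta> = 0")
    case True
    \<comment> \<open>Every pattern demands a strict sign at \<open>j\<close>, which no functional
      in \<open>S\<close> provides here.\<close>
    have "P (insert j J) S = {}"
      using True by (force simp: P_def)
    then show ?thesis unfolding P_def[symmetric] by simp
  next
    case False
    define T where "T = {\<beta>\<in>S. u j \<bullet> \<beta> = 0}"
    have "subspace T"
      using insert.prems unfolding T_def subspace_def by (auto simp: inner_add_right)
    have "T \<subset> S" using False by (auto simp: T_def)
    then have dim: "dim T < dim S"
      using \<open>subspace T\<close> insert.prems by (simp add: dim_psubset span_eq_iff[THEN iffD2])
    then obtain d where d: "dim S = Suc d" "dim T \<le> d"
      by (cases "dim S") auto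
    \<comment> \<open>The patterns are split by the sign at \<open>j\<close>, and \<open>j\<close>
      is erased from the positive ones. Then \<open>A \<union> B'\<close> consists of patterns on
      \<open>J\<close>, and \<open>A \<inter> B'\<close> of those that extend in both ways.\<close>
    define A where "A = {K \<in> P (insert j J) S. j \<notin> K}"
    define B where "B = {K \<in> P (insert j J) S. j \<in> K}"
    define B' where "B' = (\<lambda>K. K - {j}) ` B"
    have cardB: "card B' = card B"
      unfolding B'_def by (rule card_image) (auto simp: inj_on_def B_def)
    have A_sub: "A \<subseteq> P J S"
      using insert.hyps by (auto simp: A_def P_def) 
    have B'_sub: "B' \<subseteq> P J S"
    proof
      fix K assume "K \<in> B'"
      then obtain L where L: "K = L - {j}" "L \<in> P (insert j J) S" "j \<in> L"
        by (auto simp: B'_def B_def)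
      then obtain \<beta> where "\<beta> \<in> S" "\<forall>i\<in>L. u i \<bullet> \<beta> > 0" "\<forall>i\<in>insert j J - L. u i \<bullet> \<beta> < 0" "L \<subseteq> insert j J"
        by (auto simp: P_def)
      then show "K \<in> P J S" using L insert.hyps by (auto simp: P_def intro!: bexI[of _ \<beta>])
    qed
    have AB_sub: "A \<inter> B' \<subseteq> P J T"
    proof
      fix K assume K: "K \<in> A \<inter> B'"
      then obtain a where a: "a \<in> S" "\<forall>i\<in>K. u i \<bullet> a > 0" "\<forall>i\<in>insert j J - K. u i \<bullet> a < 0" 
         "j \<notin> K" "K \<subseteq> J"
        by (auto simp: P_def A_def)
      from K obtain L where L: "K = L - {j}" "L \<in> P (insert j J) S" "j \<in> L"
        by (auto simp: B'_def B_def)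
      then obtain b where b: "b \<in> S" "\<forall>i\<in>L. u i \<bullet> b > 0" "\<forall>i\<in>insert j J - L. u i \<bullet> b < 0"
        by (auto simp: P_def)
      \<comment> \<open>the positive combination of \<open>a\<close> and \<open>b\<close> that is orthogonal to \<open>u j\<close>\<close>
      define c where "c = (u j \<bullet> b) *\<^sub>R a + (- (u j \<bullet> a)) *\<^sub>R b"
      have pos: "u j \<bullet> b > 0" "- (u j \<bullet> a) > 0" using a b L by auto
      have "c \<in> T"
        using a b insert.prems unfolding c_def T_def
        by (auto intro!: subspace_add subspace_scale simp: inner_add_right simp del: scaleR_minus_left)
      moreover have "u i \<bullet> c > 0" if "i \<in> K" for i
      proof -
        have "u i \<bullet> a > 0" "u i \<bullet> b > 0" using a b L that by auto
        then show ?thesis unfolding c_def inner_add_right inner_scaleR_right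
          using pos by (intro add_pos_pos mult_pos_pos)
      qed
      moreover have "u i \<bullet> c < 0" if "i \<in> J - K" for i
      proof -
        have "u i \<bullet> a < 0" "u i \<bullet> b < 0" using a b L that insert.hyps by auto
        then show ?thesis unfolding c_def inner_add_right inner_scaleR_right
          using pos by (intro add_neg_neg mult_pos_neg)
      qed
      ultimately show "K \<in> P J T" using a by (auto simp: P_def)
    qed
    have finA: "finite A" "finite B" "finite B'" "finite (P J T)"
      using finj[of S] fin[of T] by (auto simp: A_def B_def B'_def)
    have "card (P (insert j J) S) = card A + card B"
      using finA by (subst card_Un_disjoint[symmetric]) (auto simp: A_def B_def intro: arg_cong[where f=card])
    also have "\<dots> = card (A \<union> B') + card (A \<inter> B')"
      using card_Un_Int[of A B'] finA cardB by simp
    also have "\<dots> \<le> card (P J S) + card (P J T)"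
      using A_sub B'_sub AB_sub fin finA by (intro add_mono card_mono) auto
    also have "\<dots> \<le> (\<Sum>i\<le>dim S. card J choose i) + (\<Sum>i\<le>dim T. card J choose i)"
      using insert.IH[OF insert.prems] insert.IH[OF \<open>subspace T\<close>] unfolding P_def by (rule add_mono)
    also have "\<dots> \<le> (\<Sum>i\<le>Suc d. card J choose i) + (\<Sum>i\<le>d. card J choose i)"
      using d by (intro add_mono sum_mono2) auto
    \<comment> \<open>Pascal's rule, after splitting off the term at 0, which has no counterpart in
      the sum up to \<open>d\<close>.\<close>
    also have "\<dots> = (\<Sum>i\<le>Suc d. Suc (card J) choose i)"
      by (simp add: sum.atMost_Suc_shift sum.distrib del: sum.atMost_Suc)
    finally show ?thesis
      using insert.hyps d by (simp add: P_def)
  qed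
qed

text \<open>Divided by \<open>2 ^ m\<close>, the sum is the probability that a fair binomial
  variable is at most \<open>d\<close>, and \<open>d\<close> lies at least \<open>s\<close> below
  the mean \<open>m / 2\<close>. Hoeffding's bound for the binomial distribution applies.\<close>

lemma sum_binomial_le_exp:
  fixes s :: real
  assumes "0 \<le> s" "2 * real d + 2 * s \<le> real m"
  shows "real (\<Sum>i\<le>d. m choose i) \<le> exp (- 2 * s\<^sup>2 / m) * 2 ^ m"
proof (cases "m = 0")
  case True
  \<comment> \<open>Division by zero turns the exponent into 0, and both sides equal 1.\<close>
  with assms have "d = 0" by simp
  with True show ?thesis by simp
next
  case False
  interpret binomial_distribution m "1/2" by unfold_locales auto
  have "real (\<Sum>i\<le>d. m choose i) / 2 ^ m = (\<Sum>i\<le>d. pmf (binomial_pmf m (1/2)) i)"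
    unfolding of_nat_sum sum_divide_distrib
  proof (rule sum.cong[OF refl])
    fix i assume "i \<in> {..d}"
    then have "i \<le> m" using assms by simp
    then show "real (m choose i) / 2 ^ m = pmf (binomial_pmf m (1/2)) i"
      by (simp add: power_add[symmetric] power_one_over field_simps)
  qed
  also have "\<dots> = measure_pmf.prob (binomial_pmf m (1/2)) {..d}"
    by (simp add: measure_measure_pmf_finite)
  also have "\<dots> \<le> measure_pmf.prob (binomial_pmf m (1/2)) {x. x \<le> m * (1/2) - s}"
    using assms by (intro measure_pmf.finite_measure_mono) auto
  also have "\<dots> \<le> exp (- 2 * s\<^sup>2 / m)"
    using False assms by (intro prob_le) auto
  finally show ?thesis by (simp add: field_simps)
qed

section \<open>Averaging over symmetries and concentration of counts\<close>

text \<open>By invariance each preimage of \<open>A\<close> under \<open>\<rho> k\<close> has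
  probability \<open>prob A\<close>. Averaging over \<open>k\<close> and exchanging sum and integral
  gives the expected fraction of the \<open>k\<close> that move a point into \<open>A\<close>, which
  is at most \<open>c\<close> pointwise. This takes the place of conditioning on all but the random
  signs.\<close>

lemma (in prob_space) prob_le_of_symmetries:
  fixes c :: real
  assumes K: "finite K" "K \<noteq> {}"
    and \<rho>: "\<And>k. k \<in> K \<Longrightarrow> \<rho> k \<in> measurable M M" "\<And>k. k \<in> K \<Longrightarrow> distr M M (\<rho> k) = M"
    and A[measurable]: "A \<in> sets M"
    and le: "\<And>\<omega>. \<omega> \<in> space M \<Longrightarrow> real (card {k\<in>K. \<rho> k \<omega> \<in> A}) \<le> c * card K"
  shows "prob A \<le> c"
proof -
  have int: "integrable M (\<lambda>\<omega>. indicator A (\<rho> k \<omega>) :: real)" if "k \<in> K" for k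
    using measurable_compose[OF \<rho>(1)[OF that], of "indicator A :: _ \<Rightarrow> real" borel] 
    by (intro integrable_const_bound[of _ 1]) (auto simp: indicator_def)
  have "real (card K) * prob A = (\<Sum>k\<in>K. \<integral>\<omega>. indicator A (\<rho> k \<omega>) \<partial>M)"
  proof -
    have "(\<integral>\<omega>. indicator A (\<rho> k \<omega>) \<partial>M) = prob A" if "k \<in> K" for k
    proof -
      have "(\<integral>\<omega>. indicator A (\<rho> k \<omega>) \<partial>M) = (\<integral>\<omega>. indicator A \<omega> \<partial>distr M M (\<rho> k) :: real)"
        using \<rho>(1)[OF that] by (subst integral_distr) auto
      also have "\<dots> = prob A" unfolding \<rho>(2)[OF that] using sets.sets_into_space[OF A] by (simp add: Int_absorb2)
      finally show ?thesis .
    qed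
    then show ?thesis by simp
  qed
  also have "\<dots> = (\<integral>\<omega>. (\<Sum>k\<in>K. indicator A (\<rho> k \<omega>)) \<partial>M)"
    using int by (subst Bochner_Integration.integral_sum) auto
  also have "\<dots> \<le> (\<integral>\<omega>. c * card K \<partial>M)"
  proof (rule integral_mono)
    fix \<omega> assume "\<omega> \<in> space M"
    have "(\<Sum>k\<in>K. indicator A (\<rho> k \<omega>)) = real (card {k\<in>K. \<rho> k \<omega> \<in> A})"
      using K by (simp add: indicator_def sum.If_cases Int_def)
    then show "(\<Sum>k\<in>K. indicator A (\<rho> k \<omega>)) \<le> c * card K" using le[OF \<open>\<omega> \<in> space M\<close>] by simp
  qed (use int in auto)
  also have "\<dots> = card K * c" by (simp add: prob_space)
  finally show ?thesis using K by (simp add: card_gt_0_iff)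
qed

text \<open>The count is a sum of independent indicators with values in [0, 1]. Its mean is at least
  \<open>card I * q\<close>, so the event lies within a lower deviation of \<open>\<epsilon>\<close>
  from the true mean.\<close>

lemma (in prob_space) prob_card_le_Hoeffding:
  fixes q \<epsilon> :: real
  assumes I: "finite I" "I \<noteq> {}" and indep: "indep_vars (\<lambda>_. S) Z I"
    and D[measurable]: "D \<in> sets S"
    and q: "\<And>i. i \<in> I \<Longrightarrow> q \<le> prob {\<omega>\<in>space M. Z i \<omega> \<in> D}"
    and \<epsilon>: "0 \<le> \<epsilon>"
  shows "prob {\<omega>\<in>space M. real (card {i\<in>I. Z i \<omega> \<in> D}) \<le> card I * q - \<epsilon>} \<le> exp (- 2 * \<epsilon>\<^sup>2 / card I)"
proof -
  have rv: "random_variable S (Z i)" if "i \<in> I" for i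
    using indep that by (auto simp: indep_vars_def)
  interpret Hoeffding_ineq M I "\<lambda>i \<omega>. indicator D (Z i \<omega>)" "\<lambda>_. 0" "\<lambda>_. 1"
      "\<Sum>i\<in>I. expectation (\<lambda>\<omega>. indicator D (Z i \<omega>))"
    by unfold_locales (use I in \<open>auto simp: indicator_def intro!: indep_vars_compose2[OF indep]\<close>)
  have E: "expectation (\<lambda>\<omega>. indicator D (Z i \<omega>)) = prob {\<omega>\<in>space M. Z i \<omega> \<in> D}" if "i \<in> I" for i
  proof -
    have "expectation (\<lambda>\<omega>. indicat_real D (Z i \<omega>)) = expectation (indicat_real {\<omega>\<in>space M. Z i \<omega> \<in> D})"
      by (intro Bochner_Integration.integral_cong) (auto simp: indicator_def)
    also have "\<dots> = prob {\<omega>\<in>space M. Z i \<omega> \<in> D}"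
      by (auto simp: Int_def intro!: arg_cong[where f = prob])
    finally show ?thesis .
  qed
  have cardeq: "(\<Sum>i\<in>I. indicator D (Z i \<omega>)) = real (card {i\<in>I. Z i \<omega> \<in> D})" for \<omega>
    using I by (simp add: indicator_def sum.If_cases Int_def)
  have "prob {\<omega>\<in>space M. real (card {i\<in>I. Z i \<omega> \<in> D}) \<le> card I * q - \<epsilon>}
      \<le> prob {\<omega>\<in>space M. (\<Sum>i\<in>I. indicator D (Z i \<omega>)) \<le> (\<Sum>i\<in>I. expectation (\<lambda>\<omega>. indicator D (Z i \<omega>))) - \<epsilon>}"
  proof (rule finite_measure_mono)
    have "card I * q \<le> (\<Sum>i\<in>I. expectation (\<lambda>\<omega>. indicator D (Z i \<omega>)))"
      using sum_bounded_below[of I q "\<lambda>i. expectation (\<lambda>\<omega>. indicator D (Z i \<omega>))"] q by (simp add: E)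
    then show "{\<omega>\<in>space M. real (card {i\<in>I. Z i \<omega> \<in> D}) \<le> card I * q - \<epsilon>} \<subseteq>
       {\<omega>\<in>space M. (\<Sum>i\<in>I. indicator D (Z i \<omega>)) \<le> (\<Sum>i\<in>I. expectation (\<lambda>\<omega>. indicator D (Z i \<omega>))) - \<epsilon>}"
      unfolding cardeq by auto
    show "{\<omega>\<in>space M. (\<Sum>i\<in>I. indicator D (Z i \<omega>)) \<le> (\<Sum>i\<in>I. expectation (\<lambda>\<omega>. indicator D (Z i \<omega>))) - \<epsilon>} \<in> events"
      by measurable
  qed
  also have "\<dots> \<le> exp (- 2 * \<epsilon>\<^sup>2 / (\<Sum>i\<in>I. (1 - 0)\<^sup>2))"
    using I \<epsilon> by (intro Hoeffding_ineq_le) (auto simp: card_gt_0_iff)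
  finally show ?thesis by simp
qed


text \<open>A product measure is determined by its values on boxes, and the preimage of a box under
  a coordinatewise map is the box of the preimages. This permits reflecting any subset of the
  observations.\<close>

lemma distr_PiM_coordinatewise:
  assumes "prob_space \<mu>" "finite I"
    and f[measurable]: "\<And>i. i \<in> I \<Longrightarrow> f i \<in> measurable \<mu> \<mu>"
    and distr: "\<And>i. i \<in> I \<Longrightarrow> distr \<mu> \<mu> (f i) = \<mu>"
  shows "distr (Pi\<^sub>M I (\<lambda>_. \<mu>)) (Pi\<^sub>M I (\<lambda>_. \<mu>)) (\<lambda>z. \<lambda>i\<in>I. f i (z i)) = Pi\<^sub>M I (\<lambda>_. \<mu>)"
proof -
  interpret \<mu>: prob_space \<mu> by fact
  interpret product_sigma_finite "\<lambda>_. \<mu>" ..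
  have [measurable]: "(\<lambda>z. \<lambda>i\<in>I. f i (z i)) \<in> measurable (Pi\<^sub>M I (\<lambda>_. \<mu>)) (Pi\<^sub>M I (\<lambda>_. \<mu>))"
  proof (rule measurable_restrict)
    fix i assume i: "i \<in> I"
    show "(\<lambda>z. f i (z i)) \<in> measurable (Pi\<^sub>M I (\<lambda>_. \<mu>)) \<mu>"
      using measurable_compose[OF measurable_component_singleton[OF i, of "\<lambda>_. \<mu>"] f[OF i]] .
  qed
  show ?thesis
  proof (rule PiM_eqI)
    fix A assume A: "\<And>i. i \<in> I \<Longrightarrow> A i \<in> sets \<mu>"
    have vimage: "f i -` A i \<inter> space \<mu> \<in> sets \<mu>" if "i \<in> I" for i
      using measurable_sets[OF f A] that by blast
    have "emeasure (distr (Pi\<^sub>M I (\<lambda>_. \<mu>)) (Pi\<^sub>M I (\<lambda>_. \<mu>)) (\<lambda>z. \<lambda>i\<in>I. f i (z i))) (Pi\<^sub>E I A)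
        = emeasure (Pi\<^sub>M I (\<lambda>_. \<mu>)) (\<Pi>\<^sub>E i\<in>I. f i -` A i \<inter> space \<mu>)"
      using A \<open>finite I\<close> by (subst emeasure_distr)
        (auto simp: space_PiM PiE_iff extensional_def intro!: arg_cong2[where f = emeasure] sets_PiM_I_finite)
    also have "\<dots> = (\<Prod>i\<in>I. emeasure \<mu> (f i -` A i \<inter> space \<mu>))"
      using vimage \<open>finite I\<close> by (intro emeasure_PiM) auto
    also have "\<dots> = (\<Prod>i\<in>I. emeasure \<mu> (A i))"
    proof (rule prod.cong[OF refl])
      fix i assume i: "i \<in> I"
      have "emeasure \<mu> (f i -` A i \<inter> space \<mu>) = emeasure (distr \<mu> \<mu> (f i)) (A i)"
        using f[OF i] A[OF i] by (simp add: emeasure_distr)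
      then show "emeasure \<mu> (f i -` A i \<inter> space \<mu>) = emeasure \<mu> (A i)"
        by (simp add: distr[OF i])
    qed
    finally show "emeasure (distr (Pi\<^sub>M I (\<lambda>_. \<mu>)) (Pi\<^sub>M I (\<lambda>_. \<mu>)) (\<lambda>z. \<lambda>i\<in>I. f i (z i))) (Pi\<^sub>E I A)
        = (\<Prod>i\<in>I. emeasure \<mu> (A i))" .
  qed (use \<open>finite I\<close> in auto)
qed

section \<open>Separability of a sample with symmetric signs\<close>

text \<open>Finitely many strict inequalities define an open set of \<open>\<beta>\<close>, so the
  uncountable choice from \<open>T\<close> reduces to a countable dense subset of
  \<open>T\<close>.\<close>

lemma pred_strictly_separable[measurable]:
  fixes v :: "'i \<Rightarrow> 'c \<Rightarrow> 'e::euclidean_space"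
  assumes "finite I" and [measurable]: "\<And>i. i \<in> I \<Longrightarrow> v i \<in> borel_measurable P"
    "\<And>i. i \<in> I \<Longrightarrow> Measurable.pred P (Q i)"
  shows "Measurable.pred P (\<lambda>z. \<exists>\<beta>\<in>T. \<forall>i\<in>I. Q i z \<longrightarrow> v i z \<bullet> \<beta> > 0)"
proof -
  obtain C where C: "countable C" "C \<subseteq> T" "T \<subseteq> closure C"
    using separable by blast
  have "(\<exists>\<beta>\<in>T. \<forall>i\<in>I. Q i z \<longrightarrow> v i z \<bullet> \<beta> > 0) \<longleftrightarrow> (\<exists>\<beta>\<in>C. \<forall>i\<in>I. Q i z \<longrightarrow> v i z \<bullet> \<beta> > 0)" for z
  proof
    assume "\<exists>\<beta>\<in>T. \<forall>i\<in>I. Q i z \<longrightarrow> v i z \<bullet> \<beta> > 0"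
    then obtain \<beta> where \<beta>: "\<beta> \<in> T" "\<forall>i\<in>I. Q i z \<longrightarrow> v i z \<bullet> \<beta> > 0" by blast
    define U where "U = (\<Inter>i\<in>{i\<in>I. Q i z}. {\<beta>. v i z \<bullet> \<beta> > 0})"
    have "open U" unfolding U_def using \<open>finite I\<close> by (intro open_INT) (auto intro!: open_halfspace_gt)
    moreover have "\<beta> \<in> U \<inter> closure C" using \<beta> C by (auto simp: U_def)
    ultimately have "U \<inter> C \<noteq> {}" using open_Int_closure_eq_empty by blast
    then show "\<exists>\<beta>\<in>C. \<forall>i\<in>I. Q i z \<longrightarrow> v i z \<bullet> \<beta> > 0" by (auto simp: U_def)
  qed (use C in blast)
  moreover have "Measurable.pred P (\<lambda>z. \<exists>\<beta>\<in>C. \<forall>i\<in>I. Q i z \<longrightarrow> v i z \<bullet> \<beta> > 0)"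
    unfolding pred_def
  proof (rule sets.sets_Collect_countable_Ex')
    show "{z \<in> space P. \<forall>i\<in>I. Q i z \<longrightarrow> v i z \<bullet> \<beta> > 0} \<in> sets P" for \<beta>
      using \<open>finite I\<close> by measurable
  qed fact
  ultimately show ?thesis by simp
qed

text \<open>The symmetries apply \<open>\<sigma>\<close> to the coordinates in an arbitrary set
  \<open>K\<close>. They keep the set \<open>J\<close> of indices with \<open>z i \<in> D\<close>
  and flip the signs of the \<open>u (z i)\<close> freely. For a fixed sample, the fraction of the
  \<open>K\<close> that make it separable is then bounded by the number of sign patterns on
  \<open>J\<close> over \<open>2 ^ card J\<close>.\<close>

lemma prob_symmetric_separable_le:
  fixes u :: "'c \<Rightarrow> 'e::euclidean_space" and s :: real
  assumes "prob_space \<mu>" and \<sigma>[measurable]: "\<sigma> \<in> measurable \<mu> \<mu>" and distr: "distr \<mu> \<mu> \<sigma> = \<mu>"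
    and u[measurable]: "u \<in> borel_measurable \<mu>" and u_neg: "\<And>z. z \<in> space \<mu> \<Longrightarrow> u (\<sigma> z) = - u z"
    and D[measurable]: "D \<in> sets \<mu>" and D_iff: "\<And>z. z \<in> space \<mu> \<Longrightarrow> \<sigma> z \<in> D \<longleftrightarrow> z \<in> D"
    and I: "finite I" and T: "subspace T" and s: "0 \<le> s"
  shows "{z\<in>space (Pi\<^sub>M I (\<lambda>_. \<mu>)). 2 * real (dim T) + 2 * s \<le> card {i\<in>I. z i \<in> D} \<and>
              (\<exists>\<beta>\<in>T. \<forall>i\<in>I. z i \<in> D \<longrightarrow> u (z i) \<bullet> \<beta> > 0)} \<in> sets (Pi\<^sub>M I (\<lambda>_. \<mu>))" (is "?A \<in> _")
    and "measure (Pi\<^sub>M I (\<lambda>_. \<mu>)) {z\<in>space (Pi\<^sub>M I (\<lambda>_. \<mu>)). 2 * real (dim T) + 2 * s \<le> card {i\<in>I. z i \<in> D} \<and>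
              (\<exists>\<beta>\<in>T. \<forall>i\<in>I. z i \<in> D \<longrightarrow> u (z i) \<bullet> \<beta> > 0)} \<le> exp (- 2 * s\<^sup>2 / card I)"
proof -
  let ?P = "Pi\<^sub>M I (\<lambda>_. \<mu>)"
  interpret \<mu>: prob_space \<mu> by fact
  interpret P: prob_space ?P by (intro prob_space_PiM \<open>prob_space \<mu>\<close>)
  \<comment> \<open>As a sum of indicators the count is accessible to the automatic measurability
    proof.\<close>
  have card_eq: "real (card {i\<in>I. z i \<in> D}) = (\<Sum>i\<in>I. indicator D (z i))" for z
    using I by (simp add: indicator_def sum.If_cases Int_def)
  show A: "?A \<in> sets ?P"
    unfolding card_eq using I by measurable
  define \<rho> where "\<rho> K = (\<lambda>z. \<lambda>i\<in>I. (if i \<in> K then \<sigma> else (\<lambda>x. x)) (z i))" for K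
  show "measure ?P ?A \<le> exp (- 2 * s\<^sup>2 / card I)"
  proof (rule P.prob_le_of_symmetries)
    show "\<rho> K \<in> measurable ?P ?P" for K
      unfolding \<rho>_def by (intro measurable_restrict) auto
    show "distr ?P ?P (\<rho> K) = ?P" for K
      unfolding \<rho>_def using I \<open>prob_space \<mu>\<close> distr
      by (intro distr_PiM_coordinatewise) (auto simp: distr_id)
    show "finite (Pow I)" using I by simp
    show "Pow I \<noteq> {}" by blast
    show "?A \<in> sets ?P" by fact
    fix z assume z: "z \<in> space ?P"
    then have zi: "z i \<in> space \<mu>" if "i \<in> I" for i using that by (auto simp: space_PiM)
    define J where "J = {i\<in>I. z i \<in> D}"
    have J: "finite J" "J \<subseteq> I" using I by (auto simp: J_def)
    have J_eq: "{i\<in>I. \<rho> K z i \<in> D} = J" for K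
      using zi D_iff by (auto simp: J_def \<rho>_def)
    define m where "m = card J"
    show "real (card {K \<in> Pow I. \<rho> K z \<in> ?A}) \<le> exp (- 2 * s\<^sup>2 / card I) * card (Pow I)"
    proof (cases "2 * real (dim T) + 2 * s \<le> m")
      case False
      then have "{K \<in> Pow I. \<rho> K z \<in> ?A} = {}"
        by (auto simp: J_eq m_def)
      then show ?thesis by (simp only: card.empty) simp
    next
      case True
      \<comment> \<open>The vectors are negated so that \<open>K \<inter> J\<close>, where the
        reflection turns \<open>u\<close> into \<open>- u\<close>, is the positive part of the
        pattern.\<close>
      define Q where "Q = {L. L \<subseteq> J \<and> (\<exists>\<beta>\<in>T. (\<forall>j\<in>L. (- u (z j)) \<bullet> \<beta> > 0) \<and> (\<forall>j\<in>J - L. (- u (z j)) \<bullet> \<beta> < 0))}"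
      have "finite Q" using J by (auto simp: Q_def)
      \<comment> \<open>The two components determine \<open>K\<close>. The first must be a
        realizable pattern; the second is unconstrained and accounts for the factor
        \<open>2 ^ (card I - m)\<close>.\<close>
      have "(\<lambda>K. (K \<inter> J, K - J)) ` {K \<in> Pow I. \<rho> K z \<in> ?A} \<subseteq> Q \<times> Pow (I - J)"
      proof (rule image_subsetI)
        fix K assume K: "K \<in> {K \<in> Pow I. \<rho> K z \<in> ?A}"
        then obtain \<beta> where \<beta>: "\<beta> \<in> T" "\<forall>i\<in>I. \<rho> K z i \<in> D \<longrightarrow> u (\<rho> K z i) \<bullet> \<beta> > 0" by blast
        have pos: "u (\<rho> K z i) \<bullet> \<beta> > 0" if "i \<in> J" for i
          using \<beta>(2) J_eq[of K] that by blast
        have "(- u (z i)) \<bullet> \<beta> > 0" if "i \<in> K \<inter> J" for i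
          using pos[of i] that J zi u_neg by (auto simp: \<rho>_def)
        moreover have "(- u (z i)) \<bullet> \<beta> < 0" if "i \<in> J - K \<inter> J" for i
          using pos[of i] that J by (auto simp: \<rho>_def)
        ultimately have "K \<inter> J \<in> Q" using \<beta>(1) unfolding Q_def by blast
        then show "(K \<inter> J, K - J) \<in> Q \<times> Pow (I - J)" using K by auto
      qed
      moreover have "inj_on (\<lambda>K. (K \<inter> J, K - J)) {K \<in> Pow I. \<rho> K z \<in> ?A}"
        by (rule inj_onI) blast
      ultimately have "card {K \<in> Pow I. \<rho> K z \<in> ?A} \<le> card (Q \<times> Pow (I - J))"
        using \<open>finite Q\<close> I by (intro card_inj_on_le[where f = "\<lambda>K. (K \<inter> J, K - J)"]) auto
      also have "\<dots> = card Q * 2 ^ (card I - m)"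
        using I J by (simp add: card_cartesian_product card_Pow card_Diff_subset m_def)
      finally have card_le: "card {K \<in> Pow I. \<rho> K z \<in> ?A} \<le> card Q * 2 ^ (card I - m)" .
      have "real (card Q) \<le> real (\<Sum>i\<le>dim T. m choose i)"
        unfolding Q_def m_def of_nat_le_iff using J T by (intro card_linear_dichotomies_le) auto
      also have "\<dots> \<le> exp (- 2 * s\<^sup>2 / m) * 2 ^ m"
        using s True by (rule sum_binomial_le_exp)
      finally have cardQ: "real (card Q) \<le> exp (- 2 * s\<^sup>2 / m) * 2 ^ m" .
      \<comment> \<open>The random size \<open>m\<close> is replaced by \<open>card I\<close> to
        make the bound uniform in the sample. The case \<open>m = 0\<close> is separate because of
        the division by zero; it forces \<open>s = 0\<close>.\<close>
      have exp_le: "exp (- 2 * s\<^sup>2 / m) \<le> exp (- 2 * s\<^sup>2 / card I)"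
      proof (cases "m = 0")
        case True
        then have "s = 0" using \<open>2 * real (dim T) + 2 * s \<le> m\<close> s by simp
        then show ?thesis by simp
      next
        case False
        then have "m > 0" "m \<le> card I" using I J by (auto simp: m_def card_mono)
        then have "2 * s\<^sup>2 / card I \<le> 2 * s\<^sup>2 / m" by (intro divide_left_mono) auto
        then show ?thesis by simp
      qed
      have "real (card {K \<in> Pow I. \<rho> K z \<in> ?A}) \<le> real (card Q * 2 ^ (card I - m))"
        using card_le by (rule of_nat_mono)
      also have "\<dots> = real (card Q) * 2 ^ (card I - m)" by simp
      also have "\<dots> \<le> (exp (- 2 * s\<^sup>2 / m) * 2 ^ m) * 2 ^ (card I - m)"
        using cardQ by (rule mult_right_mono) simp
      also have "\<dots> \<le> (exp (- 2 * s\<^sup>2 / card I) * 2 ^ m) * 2 ^ (card I - m)"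
        using exp_le by (intro mult_right_mono) simp_all
      also have "\<dots> = exp (- 2 * s\<^sup>2 / card I) * card (Pow I)"
        using I J card_mono[of I J] by (simp add: card_Pow m_def power_add[symmetric])
      finally show ?thesis .
    qed
  qed
qed

section \<open>Orthogonal invariance of Lebesgue measure\<close>

text \<open>
  The library version \<open>measure_orthogonal_image\<close> needs a well-ordered index type. Here we use the
  uniqueness argument for Haar measure: \<open>\<nu> = distr lborel borel f\<close> is translation invariant and
  agrees with \<open>lborel\<close> on balls.
\<close>

lemma distr_lborel_orthogonal:
  fixes f :: "'a::euclidean_space \<Rightarrow> 'a"
  assumes f: "orthogonal_transformation f"
  shows "distr lborel borel f = lborel"
proof (rule measure_eqI)
  have lin: "linear f" using f by (rule orthogonal_transformation_linear)
  then have [measurable]: "f \<in> borel_measurable borel"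
    by (intro borel_measurable_continuous_onI linear_continuous_on linear_conv_bounded_linear[THEN iffD1])
  define g where "g = inv f"
  have g: "orthogonal_transformation g" unfolding g_def using f by (rule orthogonal_transformation_inv)
  have fg: "f (g y) = y" for y
    unfolding g_def using orthogonal_transformation_surj[OF f] by (rule surj_f_inv_f)
  define \<nu> where "\<nu> = distr lborel borel f"
  have [measurable_cong]: "sets \<nu> = sets borel" by (simp add: \<nu>_def)
  \<comment> \<open>Since \<open>f\<close> is an isometry, it pulls a ball back to a ball of the
    same radius around \<open>g y\<close>.\<close>
  have \<nu>_ball: "emeasure \<nu> (ball y r) = emeasure lborel (ball y r)" if "r \<ge> 0" for y r
  proof -
    have "dist y (f z) = dist (g y) z" for z
    proof -
      have "dist y (f z) = dist (f (g y)) (f z)" by (simp add: fg)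
      also have "\<dots> = dist (g y) z" using f by (simp add: orthogonal_transformation_isometry)
      finally show ?thesis .
    qed
    then have "f -` ball y r = ball (g y) r" by auto
    then show ?thesis using that by (simp add: \<nu>_def emeasure_distr emeasure_ball)
  qed
  interpret \<nu>: sigma_finite_measure \<nu>
  proof
    show "\<exists>A. countable A \<and> A \<subseteq> sets \<nu> \<and> \<Union> A = space \<nu> \<and> (\<forall>a\<in>A. emeasure \<nu> a \<noteq> \<infinity>)"
    proof (intro exI conjI ballI)
      have "\<exists>n::nat. norm z < real n" for z :: 'a by (rule reals_Archimedean2)
      then show "\<Union> (range (\<lambda>n::nat. ball (0::'a) n)) = space \<nu>"
        by (auto simp: \<nu>_def)
    qed (auto simp: \<nu>_ball \<nu>_def[symmetric] emeasure_ball)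
  qed
  interpret pair_sigma_finite \<nu> "lborel :: 'a measure" ..
  have \<nu>_plus: "(\<integral>\<^sup>+x. h (c + x) \<partial>\<nu>) = (\<integral>\<^sup>+x. h x \<partial>\<nu>)"
    if [measurable]: "h \<in> borel_measurable borel" for h :: "'a \<Rightarrow> ennreal" and c
  proof -
    have "(\<integral>\<^sup>+x. h (c + x) \<partial>\<nu>) = (\<integral>\<^sup>+x. h (f (g c + x)) \<partial>lborel)"
      by (simp add: \<nu>_def nn_integral_distr linear_add[OF lin] fg)
    also have "\<dots> = (\<integral>\<^sup>+x. h (f x) \<partial>distr lborel borel ((+) (g c)))"
      by (simp add: nn_integral_distr)
    also have "\<dots> = (\<integral>\<^sup>+x. h x \<partial>\<nu>)"
      unfolding lborel_distr_plus by (simp add: \<nu>_def nn_integral_distr)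
    finally show ?thesis .
  qed
  have lborel_plus: "(\<integral>\<^sup>+x. h (c + x) \<partial>lborel) = (\<integral>\<^sup>+x. h x \<partial>lborel)"
    if [measurable]: "h \<in> borel_measurable borel" for h :: "'a \<Rightarrow> ennreal" and c
    by (subst (2) lborel_distr_plus[symmetric, of c]) (simp add: nn_integral_distr)
  define B :: "'a set" where "B = ball 0 1"
  have [measurable]: "B \<in> sets borel" by (simp add: B_def)
  fix A assume "A \<in> sets (distr lborel borel f)"
  then have [measurable]: "A \<in> sets borel" by simp
  \<comment> \<open>The product measure of \<open>A\<close> times \<open>B\<close> is computed by
    shifting \<open>x\<close> by \<open>y\<close> under \<open>\<nu>\<close>, then \<open>y\<close>
    by \<open>x\<close> under \<open>lborel\<close>, with Fubini in between. The inner integral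
    becomes the \<open>\<nu>\<close>-measure of the unit ball around \<open>y\<close>, which is that
    of \<open>B\<close> under \<open>lborel\<close>.\<close>
  have "emeasure \<nu> A * emeasure lborel B = (\<integral>\<^sup>+x. indicator A x * emeasure lborel B \<partial>\<nu>)"
    by (simp add: nn_integral_multc)
  also have "\<dots> = (\<integral>\<^sup>+x. (\<integral>\<^sup>+y. indicator A x * indicator B y \<partial>lborel) \<partial>\<nu>)"
    by (simp add: nn_integral_cmult)
  also have "\<dots> = (\<integral>\<^sup>+y. (\<integral>\<^sup>+x. indicator A x * indicator B y \<partial>\<nu>) \<partial>lborel)"
    by (rule Fubini'[symmetric]) measurable
  also have "\<dots> = (\<integral>\<^sup>+y. (\<integral>\<^sup>+x. indicator A (y + x) * indicator B y \<partial>\<nu>) \<partial>lborel)"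
  proof (rule nn_integral_cong)
    fix y
    show "(\<integral>\<^sup>+x. indicator A x * indicator B y \<partial>\<nu>) = (\<integral>\<^sup>+x. indicator A (y + x) * indicator B y \<partial>\<nu>)"
      using \<nu>_plus[of "\<lambda>x. indicator A x * indicator B y" y] by simp
  qed
  also have "\<dots> = (\<integral>\<^sup>+x. (\<integral>\<^sup>+y. indicator A (y + x) * indicator B y \<partial>lborel) \<partial>\<nu>)"
    by (rule Fubini') measurable
  also have "\<dots> = (\<integral>\<^sup>+x. (\<integral>\<^sup>+y. indicator A y * indicator B (y - x) \<partial>lborel) \<partial>\<nu>)"
  proof (rule nn_integral_cong)
    fix x
    show "(\<integral>\<^sup>+y. indicator A (y + x) * indicator B y \<partial>lborel) = (\<integral>\<^sup>+y. indicator A y * indicator B (y - x) \<partial>lborel)"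
      using lborel_plus[of "\<lambda>y. indicator A y * indicator B (y - x)" x] by (simp add: add.commute)
  qed
  also have "\<dots> = (\<integral>\<^sup>+y. (\<integral>\<^sup>+x. indicator A y * indicator B (y - x) \<partial>\<nu>) \<partial>lborel)"
    by (rule Fubini'[symmetric]) measurable
  also have "\<dots> = (\<integral>\<^sup>+y. indicator A y * emeasure lborel B \<partial>lborel)"
  proof (rule nn_integral_cong)
    fix y
    have "(\<integral>\<^sup>+x. indicator A y * indicator B (y - x) \<partial>\<nu>) = indicator A y * (\<integral>\<^sup>+x. indicator (ball y 1) x \<partial>\<nu>)"
      by (subst nn_integral_cmult[symmetric])
        (auto simp: B_def indicator_def dist_norm norm_minus_commute \<nu>_def intro!: nn_integral_cong borel_measurable_indicator
          split: if_splits)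
    also have "\<dots> = indicator A y * emeasure lborel B"
      by (simp add: \<nu>_ball B_def emeasure_ball)
    finally show "(\<integral>\<^sup>+x. indicator A y * indicator B (y - x) \<partial>\<nu>) = indicator A y * emeasure lborel B" .
  qed
  also have "\<dots> = emeasure lborel A * emeasure lborel B"
    by (simp add: nn_integral_multc)
  finally have "emeasure lborel B * emeasure \<nu> A = emeasure lborel B * emeasure lborel A"
    by (simp add: mult.commute)
  moreover have "emeasure lborel B \<noteq> 0" "emeasure lborel B \<noteq> top"
    by (auto simp: B_def emeasure_ball unit_ball_vol_pos less_imp_neq[symmetric])
  ultimately show "emeasure (distr lborel borel f) A = emeasure lborel A"
    by (simp add: \<nu>_def ennreal_mult_cancel_left)
qed simp

section \<open>Invariance of the law of an observation\<close>

text \<open>The conditional probability of \<open>E\<close> given \<open>X\<close> is a function of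
  \<open>h (X \<omega>)\<close>. Since \<open>R\<close> preserves both \<open>h\<close> and the law
  of \<open>X\<close>, the conditional probabilities of \<open>A\<close> for \<open>X\<close> and
  for its image under \<open>R\<close>, given \<open>h (X \<omega>)\<close>, agree. Integrating
  their product with that of \<open>E\<close> gives both sides.\<close>

lemma (in prob_space) prob_label_invariant:
  fixes X :: "'a \<Rightarrow> 'b::topological_space" and h :: "'b \<Rightarrow> 'c::topological_space"
  assumes X[measurable]: "X \<in> borel_measurable M" and R[measurable]: "R \<in> borel_measurable borel"
    and h[measurable]: "h \<in> borel_measurable borel" and hR: "\<And>v. h (R v) = h v"
    and distr: "distr M borel (\<lambda>\<omega>. R (X \<omega>)) = distr M borel X"
    and E[measurable]: "Measurable.pred M E"
    and cond: "AE \<omega> in M. cond_prob_given M E X \<omega> = cond_prob_given M E (\<lambda>\<omega>'. h (X \<omega>')) \<omega>"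
    and A[measurable]: "A \<in> sets borel"
  shows "prob {\<omega>\<in>space M. R (X \<omega>) \<in> A \<and> E \<omega>} = prob {\<omega>\<in>space M. X \<omega> \<in> A \<and> E \<omega>}"
proof -
  define F where "F = vimage_algebra (space M) X borel"
  define G where "G = vimage_algebra (space M) (\<lambda>\<omega>. h (X \<omega>)) borel"
  define e where "e = indicat_real {\<omega>\<in>space M. E \<omega>}"
  have [measurable]: "e \<in> borel_measurable M" unfolding e_def by measurable
  have subF: "subalgebra M F" unfolding F_def subalgebra_def
    by (intro conjI sets_image_in_sets) auto
  have subG: "subalgebra M G" unfolding G_def subalgebra_def
    by (intro conjI sets_image_in_sets) auto
  interpret F: finite_measure_subalgebra M F by unfold_locales (rule subF)
  interpret G: finite_measure_subalgebra M G by unfold_locales (rule subG)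
  \<comment> \<open>This \<open>G\<close>-measurable function is also a version of the conditional
    probability given \<open>X\<close>, so it can be moved through conditional expectations with
    respect to \<open>G\<close>.\<close>
  define c where "c = real_cond_exp M G e"
  have [measurable]: "c \<in> borel_measurable G" by (simp add: c_def)
  then have [measurable]: "c \<in> borel_measurable M" by (rule measurable_from_subalg[OF subG])
  have c: "AE \<omega> in M. real_cond_exp M F e \<omega> = c \<omega>"
    using cond by (simp add: cond_prob_given_def F_def G_def c_def e_def)
  have XF: "X \<in> measurable F borel" unfolding F_def by (rule measurable_vimage_algebra1) simp
  have int_ind: "integrable M (\<lambda>\<omega>. indicat_real B (Z \<omega>))" 
    if [measurable]: "B \<in> sets borel" "Z \<in> borel_measurable M" for B and Z :: "'a \<Rightarrow> 'b"
    by (intro integrable_const_bound[of _ 1]) (auto simp: indicator_def)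
  have int_e: "integrable M (\<lambda>\<omega>. indicat_real B (Z \<omega>) * e \<omega>)"
    if [measurable]: "B \<in> sets borel" "Z \<in> borel_measurable M" for B and Z :: "'a \<Rightarrow> 'b"
    by (intro integrable_const_bound[of _ 1]) (auto simp: indicator_def e_def)
  have prob_eq: "prob {\<omega>\<in>space M. X \<omega> \<in> B \<and> E \<omega>} = (\<integral>\<omega>. c \<omega> * indicat_real B (X \<omega>) \<partial>M)" 
     and int_c: "integrable M (\<lambda>\<omega>. c \<omega> * indicat_real B (X \<omega>))"
    if [measurable]: "B \<in> sets borel" for B
  proof -
    have meas: "(\<lambda>\<omega>. indicat_real B (X \<omega>)) \<in> borel_measurable F" using XF by measurable
    have "prob {\<omega>\<in>space M. X \<omega> \<in> B \<and> E \<omega>} = (\<integral>\<omega>. indicat_real {\<omega>\<in>space M. X \<omega> \<in> B \<and> E \<omega>} \<omega> \<partial>M)"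
      by (auto simp: Int_def intro!: arg_cong[where f = prob])
    also have "\<dots> = (\<integral>\<omega>. indicat_real B (X \<omega>) * e \<omega> \<partial>M)"
      by (intro Bochner_Integration.integral_cong) (auto simp: e_def indicator_def)
    also have "\<dots> = (\<integral>\<omega>. indicat_real B (X \<omega>) * real_cond_exp M F e \<omega> \<partial>M)"
      using F.real_cond_exp_intg(2)[OF int_e meas] by simp
    also have "\<dots> = (\<integral>\<omega>. c \<omega> * indicat_real B (X \<omega>) \<partial>M)"
      using c by (intro integral_cong_AE) auto
    finally show "prob {\<omega>\<in>space M. X \<omega> \<in> B \<and> E \<omega>} = (\<integral>\<omega>. c \<omega> * indicat_real B (X \<omega>) \<partial>M)" .
    have "integrable M (\<lambda>\<omega>. indicat_real B (X \<omega>) * real_cond_exp M F e \<omega>)"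
      using F.real_cond_exp_intg(1)[OF int_e meas] by simp
    then show "integrable M (\<lambda>\<omega>. c \<omega> * indicat_real B (X \<omega>))"
      by (rule Bochner_Integration.integrable_cong_AE_imp) (use c in auto)
  qed
  define a where "a = real_cond_exp M G (\<lambda>\<omega>. indicat_real A (X \<omega>))"
  have a: "AE \<omega> in M. real_cond_exp M G (\<lambda>\<omega>. indicat_real A (R (X \<omega>))) \<omega> = a \<omega>"
  proof (rule G.real_cond_exp_charact)
    fix B assume B: "B \<in> sets G"
    then obtain C where C: "B = (\<lambda>\<omega>. h (X \<omega>)) -` C \<inter> space M" and [measurable]: "C \<in> sets borel"
      unfolding G_def by (subst (asm) sets_vimage_algebra2) auto
    \<comment> \<open>The set \<open>B\<close> is described through
      \<open>h (R (X \<omega>))\<close> instead of \<open>h (X \<omega>)\<close>. The integrand then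
      depends on \<open>R (X \<omega>)\<close> alone, which has the law of \<open>X\<close>.\<close>
    have "(\<integral>\<omega>\<in>B. indicat_real A (R (X \<omega>)) \<partial>M) = (\<integral>\<omega>. indicat_real C (h (R (X \<omega>))) * indicat_real A (R (X \<omega>)) \<partial>M)"
      unfolding set_lebesgue_integral_def
      by (intro Bochner_Integration.integral_cong) (auto simp: C indicator_def hR)
    also have "\<dots> = (\<integral>v. indicat_real C (h v) * indicat_real A v \<partial>distr M borel (\<lambda>\<omega>. R (X \<omega>)))"
      by (subst integral_distr) auto
    also have "\<dots> = (\<integral>\<omega>. indicat_real C (h (X \<omega>)) * indicat_real A (X \<omega>) \<partial>M)"
      unfolding distr by (subst integral_distr) auto
    also have "\<dots> = (\<integral>\<omega>\<in>B. indicat_real A (X \<omega>) \<partial>M)"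
      unfolding set_lebesgue_integral_def
      by (intro Bochner_Integration.integral_cong) (auto simp: C indicator_def hR)
    also have "\<dots> = (\<integral>\<omega>\<in>B. a \<omega> \<partial>M)"
      unfolding a_def by (rule G.real_cond_exp_intA[OF int_ind B]) auto
    finally show "(\<integral>\<omega>\<in>B. indicat_real A (R (X \<omega>)) \<partial>M) = (\<integral>\<omega>\<in>B. a \<omega> \<partial>M)" .
  qed (use int_ind in \<open>auto simp: a_def intro!: G.real_cond_exp_int\<close>)
  have RA: "(R -` A) \<in> sets borel" using measurable_sets[OF R A] by simp
  have RA_eq: "indicat_real (R -` A) (X \<omega>) = indicat_real A (R (X \<omega>))" for \<omega> by (auto simp: indicator_def)
  have "prob {\<omega>\<in>space M. R (X \<omega>) \<in> A \<and> E \<omega>} = (\<integral>\<omega>. c \<omega> * indicat_real A (R (X \<omega>)) \<partial>M)"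
    using prob_eq[OF RA] by (simp add: RA_eq)
  also have "\<dots> = (\<integral>\<omega>. c \<omega> * real_cond_exp M G (\<lambda>\<omega>. indicat_real A (R (X \<omega>))) \<omega> \<partial>M)"
    using int_c[OF RA] by (intro G.real_cond_exp_intg(2)[symmetric]) (auto simp: RA_eq)
  also have "\<dots> = (\<integral>\<omega>. c \<omega> * a \<omega> \<partial>M)"
    using a by (intro integral_cong_AE) (auto simp: a_def)
  also have "\<dots> = (\<integral>\<omega>. c \<omega> * indicat_real A (X \<omega>) \<partial>M)"
    unfolding a_def using int_c[OF A] by (intro G.real_cond_exp_intg(2)) auto
  also have "\<dots> = prob {\<omega>\<in>space M. X \<omega> \<in> A \<and> E \<omega>}"
    using prob_eq[OF A] by simp
  finally show ?thesis .
qed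

text \<open>The map fixes \<open>b\<close> and negates its orthogonal complement. In the expanded
  inner product, \<open>(b \<bullet> v) * (b \<bullet> w)\<close> occurs with coefficients 4, -2 and
  -2, which cancel.\<close>

lemma orthogonal_axis_reflection:
  fixes b :: "'a::real_inner"
  assumes "norm b = 1"
  shows "orthogonal_transformation (\<lambda>v. (2 * (b \<bullet> v)) *\<^sub>R b - v)"
proof -
  have "b \<bullet> b = 1" using assms by (simp add: norm_eq_1)
  then have "((2 * (b \<bullet> v)) *\<^sub>R b - v) \<bullet> ((2 * (b \<bullet> w)) *\<^sub>R b - w) = v \<bullet> w" for v w
    by (simp add: inner_diff_left inner_diff_right inner_commute[of v b])
  moreover have "linear (\<lambda>v. (2 * (b \<bullet> v)) *\<^sub>R b - v)"
    by (rule linearI) (simp_all add: inner_add_right algebra_simps)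
  ultimately show ?thesis
    by (simp add: orthogonal_transformation_def)
qed

lemma std_normal_vec_density_orthogonal:
  fixes f :: "real ^ 'p \<Rightarrow> real ^ 'p"
  shows "orthogonal_transformation f \<Longrightarrow> std_normal_vec_density (f v) = std_normal_vec_density v"
  by (simp add: std_normal_vec_density_def orthogonal_transformation_norm)

text \<open>The density depends on the norm only, and Lebesgue measure is invariant under
  \<open>R\<close>.\<close>

lemma distr_std_normal_orthogonal:
  fixes X :: "'a \<Rightarrow> real ^ 'p"
  assumes X: "distributed M lborel X (\<lambda>v. ennreal (std_normal_vec_density v))"
    and R: "orthogonal_transformation R"
  shows "distr M borel (\<lambda>\<omega>. R (X \<omega>)) = distr M borel X"
proof (rule measure_eqI)
  have [measurable]: "R \<in> borel_measurable borel"
    using orthogonal_transformation_linear[OF R]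
    by (intro borel_measurable_continuous_onI linear_continuous_on linear_conv_bounded_linear[THEN iffD1])
  have [measurable]: "X \<in> borel_measurable M"
    using distributed_measurable[OF X] by simp
  have [measurable]: "(\<lambda>v. ennreal (std_normal_vec_density (v :: real ^ 'p))) \<in> borel_measurable borel"
    using distributed_borel_measurable[OF X] by simp
  fix A assume "A \<in> sets (distr M borel (\<lambda>\<omega>. R (X \<omega>)))"
  then have A[measurable]: "A \<in> sets borel" by simp
  have RA: "R -` A \<in> sets borel" using measurable_sets[of R borel borel A] by simp
  have "emeasure (distr M borel (\<lambda>\<omega>. R (X \<omega>))) A = emeasure M (X -` (R -` A) \<inter> space M)"
    by (simp add: emeasure_distr vimage_def)
  also have "\<dots> = (\<integral>\<^sup>+v. ennreal (std_normal_vec_density v) * indicator (R -` A) v \<partial>lborel)"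
    using RA by (intro distributed_emeasure[OF X]) simp
  also have "\<dots> = (\<integral>\<^sup>+v. ennreal (std_normal_vec_density (R v)) * indicator A (R v) \<partial>lborel)"
    by (intro nn_integral_cong) (simp add: std_normal_vec_density_orthogonal[OF R] indicator_def)
  also have "\<dots> = (\<integral>\<^sup>+v. ennreal (std_normal_vec_density v) * indicator A v \<partial>distr lborel borel R)"
    by (simp add: nn_integral_distr)
  also have "\<dots> = (\<integral>\<^sup>+v. ennreal (std_normal_vec_density v) * indicator A v \<partial>lborel)"
    by (simp only: distr_lborel_orthogonal[OF R])
  also have "\<dots> = emeasure M (X -` A \<inter> space M)"
    by (intro distributed_emeasure[OF X, symmetric]) simp
  also have "\<dots> = emeasure (distr M borel X) A"
    by (simp add: emeasure_distr)
  finally show "emeasure (distr M borel (\<lambda>\<omega>. R (X \<omega>))) A = emeasure (distr M borel X) A" .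
qed simp

lemma measurable_obs_space [measurable]:
  "fst \<in> borel_measurable (obs_space :: ((real ^ 'p) \<times> real) measure)"
  "snd \<in> borel_measurable (obs_space :: ((real ^ 'p) \<times> real) measure)"
  "snd \<in> measurable (obs_space :: ((real ^ 'p) \<times> real) measure) (count_space {-1, 1})"
proof -
  show 1: "snd \<in> measurable (obs_space :: ((real ^ 'p) \<times> real) measure) (count_space {-1, 1})"
    unfolding obs_space_def by measurable
  show "snd \<in> borel_measurable (obs_space :: ((real ^ 'p) \<times> real) measure)"
    using measurable_compose[OF 1, of "\<lambda>x. x" borel] by simp
qed (simp add: obs_space_def)

lemma measurable_obs_spaceI:
  "f \<in> borel_measurable M \<Longrightarrow> g \<in> measurable M (count_space {-1, 1}) \<Longrightarrow>
    (\<lambda>\<omega>. (f \<omega>, g \<omega>)) \<in> measurable M obs_space"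
  unfolding obs_space_def by (rule measurable_Pair)

text \<open>As the label is discrete, an event splits into its sections at the labels 1 and -1. The
  first is covered by \<open>prob_label_invariant\<close>, the second by subtraction from the law of
  \<open>x\<close>.\<close>

lemma (in prob_space) distr_obs_reflect:
  fixes x :: "'a \<Rightarrow> real ^ 'p"
  assumes xy: "(\<lambda>\<omega>. (x \<omega>, y \<omega>)) \<in> measurable M obs_space"
    and x: "distributed M lborel x (\<lambda>v. ennreal (std_normal_vec_density v))"
    and cond: "AE \<omega> in M. cond_prob_given M (\<lambda>\<omega>'. y \<omega>' = 1) x \<omega> =
                    cond_prob_given M (\<lambda>\<omega>'. y \<omega>' = 1) (\<lambda>\<omega>'. x \<omega>' \<bullet> b) \<omega>"
    and R: "orthogonal_transformation R" and Rb: "\<And>v. R v \<bullet> b = v \<bullet> b"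
  shows "distr M obs_space (\<lambda>\<omega>. (R (x \<omega>), y \<omega>)) = distr M obs_space (\<lambda>\<omega>. (x \<omega>, y \<omega>))"
proof (rule measure_eqI)
  have [measurable]: "R \<in> borel_measurable borel"
    using orthogonal_transformation_linear[OF R]
    by (intro borel_measurable_continuous_onI linear_continuous_on linear_conv_bounded_linear[THEN iffD1])
  have [measurable]: "x \<in> borel_measurable M"
    using distributed_measurable[OF x] by simp
  have y[measurable]: "y \<in> measurable M (count_space {-1, 1})"
    using measurable_compose[OF xy measurable_obs_space(3)] by simp
  have [measurable]: "y \<in> borel_measurable M"
    using measurable_compose[OF xy measurable_obs_space(2)] by simp
  have [measurable]: "(\<lambda>\<omega>. (R (x \<omega>), y \<omega>)) \<in> measurable M obs_space"
    by (intro measurable_obs_spaceI) measurable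
  note xy[measurable]
  have y_cases: "y \<omega> = 1 \<or> y \<omega> = -1" if "\<omega> \<in> space M" for \<omega>
    using measurable_space[OF y that] by auto
  note distr_R = distr_std_normal_orthogonal[OF x R]
  have pos: "prob {\<omega>\<in>space M. R (x \<omega>) \<in> A \<and> y \<omega> = 1} = prob {\<omega>\<in>space M. x \<omega> \<in> A \<and> y \<omega> = 1}"
    if "A \<in> sets borel" for A
    using that cond distr_R by (intro prob_label_invariant[where h = "\<lambda>v. v \<bullet> b"]) (auto simp: Rb)
  have all: "prob {\<omega>\<in>space M. R (x \<omega>) \<in> A} = prob {\<omega>\<in>space M. x \<omega> \<in> A}"
    if [measurable]: "A \<in> sets borel" for A
  proof -
    have "prob {\<omega>\<in>space M. R (x \<omega>) \<in> A} = measure (distr M borel (\<lambda>\<omega>. R (x \<omega>))) A"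
      by (subst measure_distr) (auto intro!: arg_cong[where f = prob])
    also have "\<dots> = prob {\<omega>\<in>space M. x \<omega> \<in> A}"
      unfolding distr_R by (subst measure_distr) (auto intro!: arg_cong[where f = prob])
    finally show ?thesis .
  qed
  have split_all: "prob {\<omega>\<in>space M. Z \<omega> \<in> A} = prob {\<omega>\<in>space M. Z \<omega> \<in> A \<and> y \<omega> = 1} + prob {\<omega>\<in>space M. Z \<omega> \<in> A \<and> y \<omega> = -1}"
    if [measurable]: "A \<in> sets borel" "Z \<in> borel_measurable M" for A and Z :: "'a \<Rightarrow> real ^ 'p"
    using y_cases by (subst finite_measure_Union[symmetric]) (auto intro!: arg_cong[where f = prob])
  have neg: "prob {\<omega>\<in>space M. R (x \<omega>) \<in> A \<and> y \<omega> = -1} = prob {\<omega>\<in>space M. x \<omega> \<in> A \<and> y \<omega> = -1}"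
    if A: "A \<in> sets borel" for A
    using split_all[OF A, of "\<lambda>\<omega>. R (x \<omega>)"] split_all[OF A, of x] pos[OF A] all[OF A] by simp
  fix C assume "C \<in> sets (distr M obs_space (\<lambda>\<omega>. (R (x \<omega>), y \<omega>)))"
  then have C[measurable]: "C \<in> sets obs_space" by simp
  have C_sec: "{v. (v, c) \<in> C} \<in> sets borel" if "c \<in> {-1, 1}" for c :: real
  proof -
    have "(\<lambda>v. (v, c)) \<in> measurable borel obs_space"
      using that by (intro measurable_obs_spaceI) auto
    from measurable_sets[OF this C] show ?thesis by (simp add: vimage_def)
  qed
  have split_C: "prob {\<omega>\<in>space M. (Z \<omega>, y \<omega>) \<in> C}
      = prob {\<omega>\<in>space M. Z \<omega> \<in> {v. (v, 1) \<in> C} \<and> y \<omega> = 1} + prob {\<omega>\<in>space M. Z \<omega> \<in> {v. (v, -1) \<in> C} \<and> y \<omega> = -1}"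
    if [measurable]: "Z \<in> borel_measurable M" for Z
  proof -
    have [measurable]: "{v. (v, 1) \<in> C} \<in> sets borel" "{v. (v, -1) \<in> C} \<in> sets borel"
      using C_sec by auto
    have "{\<omega>\<in>space M. (Z \<omega>, y \<omega>) \<in> C} = {\<omega>\<in>space M. Z \<omega> \<in> {v. (v, 1) \<in> C} \<and> y \<omega> = 1} \<union> {\<omega>\<in>space M. Z \<omega> \<in> {v. (v, -1) \<in> C} \<and> y \<omega> = -1}"
      using y_cases by force
    moreover have "{\<omega>\<in>space M. Z \<omega> \<in> {v. (v, 1) \<in> C} \<and> y \<omega> = 1} \<in> events"
      "{\<omega>\<in>space M. Z \<omega> \<in> {v. (v, -1) \<in> C} \<and> y \<omega> = -1} \<in> events" by measurable
    ultimately show ?thesis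
      by (simp only:) (rule finite_measure_Union, auto)
  qed
  have emeasure_C: "emeasure (distr M obs_space (\<lambda>\<omega>. (Z \<omega>, y \<omega>))) C = prob {\<omega>\<in>space M. (Z \<omega>, y \<omega>) \<in> C}"
    if [measurable]: "Z \<in> borel_measurable M" for Z
  proof -
    have "(\<lambda>\<omega>. (Z \<omega>, y \<omega>)) \<in> measurable M obs_space"
      by (intro measurable_obs_spaceI) measurable
    then have "emeasure (distr M obs_space (\<lambda>\<omega>. (Z \<omega>, y \<omega>))) C = emeasure M ((\<lambda>\<omega>. (Z \<omega>, y \<omega>)) -` C \<inter> space M)"
      using C by (rule emeasure_distr)
    also have "(\<lambda>\<omega>. (Z \<omega>, y \<omega>)) -` C \<inter> space M = {\<omega>\<in>space M. (Z \<omega>, y \<omega>) \<in> C}"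
      by auto
    finally show ?thesis by (simp only: emeasure_eq_measure)
  qed
  have "prob {\<omega>\<in>space M. (R (x \<omega>), y \<omega>) \<in> C} = prob {\<omega>\<in>space M. (x \<omega>, y \<omega>) \<in> C}"
    using split_C[of "\<lambda>\<omega>. R (x \<omega>)"] split_C[of x] pos[OF C_sec] neg[OF C_sec] by simp
  then show "emeasure (distr M obs_space (\<lambda>\<omega>. (R (x \<omega>), y \<omega>))) C = emeasure (distr M obs_space (\<lambda>\<omega>. (x \<omega>, y \<omega>))) C"
    using emeasure_C[of "\<lambda>\<omega>. R (x \<omega>)"] emeasure_C[of x] by simp
qed simp

theorem theorem4:
  fixes M :: "'a measure" and N :: "'b measure"
    and X :: "nat \<Rightarrow> 'a \<Rightarrow> real ^ 'p" and Y :: "nat \<Rightarrow> 'a \<Rightarrow> real"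
    and x :: "'b \<Rightarrow> real ^ 'p" and y :: "'b \<Rightarrow> real"
    and \<beta>s :: "real ^ 'p" and n :: nat and t :: real
  assumes "1 \<le> CARD('p)" and "CARD('p) < n"
    and "prob_space M" and "prob_space N"
    and "(\<lambda>\<omega>. (x \<omega>, y \<omega>)) \<in> measurable N obs_space"
    and "prob_space.indep_vars M (\<lambda>_. obs_space) (\<lambda>j \<omega>. (X j \<omega>, Y j \<omega>)) {1..n}"
    and "\<And>j. j \<in> {1..n} \<Longrightarrow>
          distr M obs_space (\<lambda>\<omega>. (X j \<omega>, Y j \<omega>)) = distr N obs_space (\<lambda>\<omega>. (x \<omega>, y \<omega>))"
    and "distributed N lborel x (\<lambda>v. ennreal (std_normal_vec_density v))"
    and "\<beta>s \<in> sphere 0 1"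
    and "AE \<omega> in N. cond_prob_given N (\<lambda>\<omega>'. y \<omega>' = 1) x \<omega> =
                    cond_prob_given N (\<lambda>\<omega>'. y \<omega>' = 1) (\<lambda>\<omega>'. x \<omega>' \<bullet> \<beta>s) \<omega>"
    and "t \<ge> 0"
    and "2 * (real CARD('p) - 1) / real n + (4 + 1 / sqrt 2) * sqrt (t / real n)
           \<le> measure N {\<omega> \<in> space N. y \<omega> * (x \<omega> \<bullet> \<beta>s) < 0}"
    and "measure N {\<omega> \<in> space N. y \<omega> * (x \<omega> \<bullet> \<beta>s) < 0} \<le> 1 / 2"
  shows "separability_prob M X Y n \<le> 3 * exp (- t)"
proof -

  \<comment> \<open>The reflection that fixes the true direction\<close>
  interpret M: prob_space M by fact
  interpret N: prob_space N by fact
  note xy[measurable] = assms(5)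
  define b where "b = \<beta>s"
  have nb: "norm b = 1" using assms(9) by (simp add: b_def)
  then have bb: "b \<bullet> b = 1" by (simp add: norm_eq_1)
  define R where "R v = (2 * (b \<bullet> v)) *\<^sub>R b - v" for v
  have R: "orthogonal_transformation R"
    unfolding R_def using nb by (rule orthogonal_axis_reflection)
  have Rb: "R v \<bullet> b = v \<bullet> b" for v
    by (simp add: R_def inner_diff_left bb inner_commute[of v b])
  have [measurable]: "R \<in> borel_measurable borel"
    unfolding R_def by measurable
  have n: "n > 0" using assms(2) by simp
  define I where "I = {1..n}"
  have I: "finite I" "I \<noteq> {}" "card I = n" using n by (auto simp: I_def)
  define \<mu> where "\<mu> = distr N obs_space (\<lambda>\<omega>. (x \<omega>, y \<omega>))"
  have [measurable_cong]: "sets \<mu> = sets obs_space" by (simp add: \<mu>_def)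
  have space_\<mu>: "space \<mu> = space obs_space" by (simp add: \<mu>_def)
  interpret \<mu>: prob_space \<mu> unfolding \<mu>_def using xy by (rule N.prob_space_distr)
  define \<sigma> where "\<sigma> z = (R (fst z), snd z)" for z :: "(real ^ 'p) \<times> real"
  have \<sigma>_obs: "\<sigma> \<in> measurable obs_space obs_space"
    unfolding \<sigma>_def by (intro measurable_obs_spaceI measurable_obs_space(3)) measurable
  have \<sigma>: "\<sigma> \<in> measurable \<mu> \<mu>"
    using \<sigma>_obs by (simp add: \<mu>_def)
  have \<sigma>_distr: "distr \<mu> \<mu> \<sigma> = \<mu>"
  proof -
    have "distr \<mu> \<mu> \<sigma> = distr \<mu> obs_space \<sigma>"
      by (rule distr_cong) (simp_all add: \<mu>_def)
    also have "\<dots> = distr N obs_space (\<lambda>\<omega>. (R (x \<omega>), y \<omega>))"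
      unfolding \<mu>_def using \<sigma>_obs xy by (subst distr_distr) (auto simp: comp_def \<sigma>_def)
    also have "\<dots> = \<mu>"
      unfolding \<mu>_def using N.distr_obs_reflect[OF xy assms(8,10) R] Rb by (simp add: b_def)
    finally show ?thesis .
  qed
  \<comment> \<open>The tangential part of the labelled feature vector. The reflection keeps the
    label, hence negates \<open>u\<close>.\<close>
  define u where "u z = snd z *\<^sub>R (fst z - (b \<bullet> fst z) *\<^sub>R b)" for z :: "(real ^ 'p) \<times> real"
  have u_obs: "u \<in> borel_measurable obs_space"
    unfolding u_def by measurable
  have u: "u \<in> borel_measurable \<mu>"
    using u_obs by (simp add: \<mu>_def)
  have u_neg: "u (\<sigma> z) = - u z" for z
  proof -
    have "R v - (b \<bullet> R v) *\<^sub>R b = - (v - (b \<bullet> v) *\<^sub>R b)" for v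
    proof -
      have "b \<bullet> R v = b \<bullet> v" using Rb[of v] by (simp only: inner_commute)
      moreover have "R v = (b \<bullet> v) *\<^sub>R b + (b \<bullet> v) *\<^sub>R b - v"
        unfolding R_def mult_2 by (simp only: scaleR_left_distrib)
      ultimately show ?thesis by simp
    qed
    then show ?thesis
      unfolding u_def \<sigma>_def fst_conv snd_conv by (simp only: scaleR_minus_right)
  qed
  define T where "T = {w. b \<bullet> w = 0}"
  have T: "subspace T" unfolding T_def by (rule subspace_hyperplane)
  have dim_T: "real (dim T) = real CARD('p) - 1"
  proof -
    have "b \<noteq> 0" using nb by auto
    from dim_hyperplane[OF this] show ?thesis
      using assms(1) by (simp add: T_def of_nat_diff)
  qed

  \<comment> \<open>Thresholds for the two index sets\<close>
  define D where "D P = {z \<in> space obs_space. P (snd z * (fst z \<bullet> b))}" for P :: "real \<Rightarrow> bool"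
  \<comment> \<open>\<open>\<epsilon>\<close> is chosen so that Hoeffding's bound for
    \<open>n\<close> observations is exactly \<open>exp (- t)\<close>. The remaining margin
    \<open>4 * sqrt (n * t)\<close> is \<open>2 * s\<close>, which yields
    \<open>exp (- 8 * t)\<close> in the counting bound.\<close>
  define s where "s = 2 * sqrt (n * t)"
  define \<epsilon> where "\<epsilon> = sqrt (n * t) / sqrt 2"
  define q where "q = 2 * (real CARD('p) - 1) / real n + (4 + 1 / sqrt 2) * sqrt (t / real n)"
  have s0: "0 \<le> s" and \<epsilon>0: "0 \<le> \<epsilon>" using assms(11) by (auto simp: s_def \<epsilon>_def)
  have s2: "exp (- 2 * s\<^sup>2 / card I) = exp (- 8 * t)"
    using assms(11) n by (simp add: s_def power_mult_distrib I)
  have \<epsilon>2: "exp (- 2 * \<epsilon>\<^sup>2 / card I) = exp (- t)"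
    using assms(11) n by (simp add: \<epsilon>_def power_divide I)
  \<comment> \<open>With \<open>n * sqrt (t / n) = sqrt (n * t)\<close>, the summand
    \<open>1 / sqrt 2\<close> in \<open>q\<close> pays for \<open>\<epsilon>\<close>. A count above
    the Hoeffding threshold is thus large enough for the counting bound.\<close>
  have q_eq: "card I * q - \<epsilon> = 2 * real (dim T) + 2 * s"
  proof -
    define r where "r = sqrt (t / n)"
    have r: "sqrt (n * t) = real n * r"
      using n assms(11) by (simp add: r_def real_sqrt_divide real_sqrt_mult field_simps)
    have "card I * q - \<epsilon> = real n * (2 * real (dim T) / n) + real n * (4 + 1 / sqrt 2) * r - real n * r / sqrt 2"
      by (simp add: q_def \<epsilon>_def dim_T I r r_def[symmetric] distrib_left)
    also have "\<dots> = 2 * real (dim T) + 2 * s"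
      using n by (simp add: s_def r ring_distribs)
    finally show ?thesis .
  qed

  \<comment> \<open>Bounds for the exceptional events\<close>
  let ?P = "Pi\<^sub>M I (\<lambda>_. \<mu>)"
  define Z where "Z i \<omega> = (X i \<omega>, Y i \<omega>)" for i \<omega>
  have indep: "M.indep_vars (\<lambda>_. obs_space) Z I"
    using assms(6) by (simp add: Z_def[abs_def] I_def)
  have Z[measurable]: "Z i \<in> measurable M obs_space" if "i \<in> I" for i
    using indep that by (auto simp: M.indep_vars_def)
  have Z_distr: "distr M obs_space (Z i) = \<mu>" if "i \<in> I" for i
    using assms(7)[of i] that by (simp add: Z_def[abs_def] \<mu>_def I_def)
  have sets_P: "sets ?P = sets (Pi\<^sub>M I (\<lambda>_. obs_space))"
    by (intro sets_PiM_cong) (simp_all add: \<mu>_def)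
  have Z_P: "(\<lambda>\<omega>. \<lambda>i\<in>I. Z i \<omega>) \<in> measurable M ?P"
    unfolding measurable_cong_sets[OF refl sets_P] by (intro measurable_restrict Z)
  have distr_P: "distr M ?P (\<lambda>\<omega>. \<lambda>i\<in>I. Z i \<omega>) = ?P"
  proof -
    have "distr M ?P (\<lambda>\<omega>. \<lambda>i\<in>I. Z i \<omega>) = distr M (Pi\<^sub>M I (\<lambda>_. obs_space)) (\<lambda>\<omega>. \<lambda>i\<in>I. Z i \<omega>)"
      using sets_P by (intro distr_cong) auto
    also have "\<dots> = Pi\<^sub>M I (\<lambda>i. distr M obs_space (Z i))"
      using indep by (subst (asm) M.indep_vars_iff_distr_eq_PiM'[OF I(2)]) (auto intro: Z)
    also have "\<dots> = ?P"
      by (intro PiM_cong) (simp_all add: Z_distr)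
    finally show ?thesis .
  qed
  \<comment> \<open>For a condition \<open>Q\<close> on the margin
    \<open>snd z * (fst z \<bullet> b)\<close>: \<open>few Q\<close> says that few observations
    satisfy it, \<open>sep Q\<close> that many do and their tangential parts are separable.
    \<open>sep' Q\<close> is the pullback of \<open>sep Q\<close> from the product space to
    \<open>M\<close>.\<close>
  define few where "few Q = {\<omega>\<in>space M. real (card {i\<in>I. Z i \<omega> \<in> D Q}) \<le> card I * q - \<epsilon>}" for Q
  define sep where "sep Q = {z\<in>space ?P. 2 * real (dim T) + 2 * s \<le> card {i\<in>I. z i \<in> D Q} \<and>
              (\<exists>\<beta>\<in>T. \<forall>i\<in>I. z i \<in> D Q \<longrightarrow> u (z i) \<bullet> \<beta> > 0)}" for Q
  define sep' where "sep' Q = (\<lambda>\<omega>. \<lambda>i\<in>I. Z i \<omega>) -` sep Q \<inter> space M" for Q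
  have bounds: "few Q \<in> M.events \<and> sep' Q \<in> M.events \<and> M.prob (few Q) \<le> exp (- t) \<and> M.prob (sep' Q) \<le> exp (- 8 * t)"
    if [measurable]: "Measurable.pred borel Q" and le: "q \<le> measure N {\<omega> \<in> space N. Q (y \<omega> * (x \<omega> \<bullet> b))}" for Q
  proof (intro conjI)
    have D[measurable]: "D Q \<in> sets obs_space" unfolding D_def by measurable
    \<comment> \<open>The reflection changes neither the label nor the component along
      \<open>b\<close>, so the margin is preserved.\<close>
    have D_iff: "\<sigma> z \<in> D Q \<longleftrightarrow> z \<in> D Q" if "z \<in> space \<mu>" for z
      using measurable_space[OF \<sigma>_obs, of z] that by (auto simp: D_def space_\<mu> \<sigma>_def Rb)
    have D\<mu>: "D Q \<in> sets \<mu>" using D by (simp add: \<mu>_def)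
    have q_le: "q \<le> M.prob {\<omega>\<in>space M. Z i \<omega> \<in> D Q}" if i: "i \<in> I" for i
    proof -
      have "{\<omega> \<in> space N. Q (y \<omega> * (x \<omega> \<bullet> b))} = (\<lambda>\<omega>. (x \<omega>, y \<omega>)) -` D Q \<inter> space N"
        using measurable_space[OF xy] by (auto simp: D_def)
      then have "q \<le> measure \<mu> (D Q)"
        using le xy D by (simp add: \<mu>_def measure_distr)
      also have "\<dots> = M.prob (Z i -` D Q \<inter> space M)"
        unfolding Z_distr[OF i, symmetric] using Z[OF i] D by (rule measure_distr)
      also have "Z i -` D Q \<inter> space M = {\<omega>\<in>space M. Z i \<omega> \<in> D Q}" by auto
      finally show ?thesis .
    qed
    have "real (card {i\<in>I. Z i \<omega> \<in> D Q}) = (\<Sum>i\<in>I. indicator (D Q) (Z i \<omega>))" for \<omega>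
      using I by (simp add: indicator_def sum.If_cases Int_def)
    then show "few Q \<in> M.events" unfolding few_def by measurable
    show "M.prob (few Q) \<le> exp (- t)"
      using M.prob_card_le_Hoeffding[OF I(1,2) indep D q_le \<epsilon>0] unfolding \<epsilon>2 few_def .
    note sep_bound = prob_symmetric_separable_le[OF \<mu>.prob_space_axioms \<sigma> \<sigma>_distr u u_neg D\<mu> D_iff I(1) T s0]
    have sep: "sep Q \<in> sets ?P" unfolding sep_def by (rule sep_bound(1))
    then show "sep' Q \<in> M.events" unfolding sep'_def by (rule measurable_sets[OF Z_P])
    have "M.prob (sep' Q) = measure (distr M ?P (\<lambda>\<omega>. \<lambda>i\<in>I. Z i \<omega>)) (sep Q)"
      unfolding sep'_def using Z_P sep by (rule measure_distr[symmetric])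
    also have "\<dots> \<le> exp (- 8 * t)"
      unfolding distr_P sep_def s2[symmetric] by (rule sep_bound(2))
    finally show "M.prob (sep' Q) \<le> exp (- 8 * t)" .
  qed
  define neg where "neg = (\<lambda>r::real. r < 0)"
  define nonneg where "nonneg = (\<lambda>r::real. r \<ge> 0)"
  have [measurable]: "x \<in> borel_measurable N" "y \<in> borel_measurable N"
    using measurable_compose[OF xy measurable_obs_space(1)] measurable_compose[OF xy measurable_obs_space(2)] by simp_all
  have q_neg: "q \<le> measure N {\<omega> \<in> space N. neg (y \<omega> * (x \<omega> \<bullet> b))}"
    using assms(12) by (simp add: q_def neg_def b_def)
  \<comment> \<open>The upper bound \<open>1 / 2\<close> enters here: a nonnegative margin has
    probability at least \<open>1 / 2\<close>, hence at least \<open>q\<close>.\<close>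
  have q_nonneg: "q \<le> measure N {\<omega> \<in> space N. nonneg (y \<omega> * (x \<omega> \<bullet> b))}"
  proof -
    have "measure N {\<omega> \<in> space N. \<not> (y \<omega> * (x \<omega> \<bullet> b) < 0)} = 1 - measure N {\<omega> \<in> space N. y \<omega> * (x \<omega> \<bullet> b) < 0}"
      by (rule N.prob_neg) measurable
    then show ?thesis
      using assms(12,13) by (simp add: q_def nonneg_def b_def not_less)
  qed
  have neg: "few neg \<in> M.events" "sep' neg \<in> M.events" "M.prob (few neg) \<le> exp (- t)" "M.prob (sep' neg) \<le> exp (- 8 * t)"
    using bounds[OF _ q_neg] by (auto simp: neg_def)
  have nonneg: "few nonneg \<in> M.events" "sep' nonneg \<in> M.events" "M.prob (few nonneg) \<le> exp (- t)" "M.prob (sep' nonneg) \<le> exp (- 8 * t)"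
    using bounds[OF _ q_nonneg] by (auto simp: nonneg_def)

  \<comment> \<open>Covering the separable samples\<close>
  have sub: "(\<Union>\<beta>. {\<omega> \<in> space M. \<forall>j\<in>{1..n}. Y j \<omega> * (X j \<omega> \<bullet> \<beta>) > 0})
      \<subseteq> (few neg \<union> few nonneg) \<union> (sep' neg \<union> sep' nonneg)"
  proof clarify
    fix \<omega> \<beta> assume \<omega>: "\<omega> \<in> space M" and pos: "\<forall>j\<in>{1..n}. Y j \<omega> * (X j \<omega> \<bullet> \<beta>) > 0"
      and not_sep: "\<omega> \<notin> sep' nonneg" "\<omega> \<notin> sep' neg" and not_few: "\<omega> \<notin> few nonneg"
    define w where "w = \<beta> - (b \<bullet> \<beta>) *\<^sub>R b"
    have w: "w \<in> T" by (simp add: w_def T_def inner_diff_right bb)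
    have decomp: "Y j \<omega> * (X j \<omega> \<bullet> \<beta>) = (b \<bullet> \<beta>) * (snd (Z j \<omega>) * (fst (Z j \<omega>) \<bullet> b)) + u (Z j \<omega>) \<bullet> w" for j
      by (simp add: w_def Z_def u_def inner_diff_left inner_diff_right bb inner_commute algebra_simps)
    \<comment> \<open>On the indices in \<open>D Q\<close> the component of \<open>\<beta>\<close>
      along \<open>b\<close> contributes a nonpositive amount to a positive value, so the tangential
      part \<open>w\<close> alone must separate them.\<close>
    have in_sep: "\<omega> \<in> sep' Q" if "\<omega> \<notin> few Q" and "\<And>r. Q r \<Longrightarrow> (b \<bullet> \<beta>) * r \<le> 0" for Q
    proof -
      have "u (Z i \<omega>) \<bullet> w > 0" if "i \<in> I" "Z i \<omega> \<in> D Q" for i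
      proof -
        have "(b \<bullet> \<beta>) * (snd (Z i \<omega>) * (fst (Z i \<omega>) \<bullet> b)) \<le> 0"
          using that(2) \<open>\<And>r. Q r \<Longrightarrow> (b \<bullet> \<beta>) * r \<le> 0\<close> by (simp add: D_def)
        moreover have "Y i \<omega> * (X i \<omega> \<bullet> \<beta>) > 0" using pos that(1) by (simp add: I_def)
        ultimately show ?thesis using decomp[of i] by linarith
      qed
      moreover have "2 * real (dim T) + 2 * s \<le> card {i\<in>I. Z i \<omega> \<in> D Q}"
        using \<open>\<omega> \<notin> few Q\<close> \<omega> by (simp add: few_def q_eq)
      moreover have "{i\<in>I. (\<lambda>i\<in>I. Z i \<omega>) i \<in> D Q} = {i\<in>I. Z i \<omega> \<in> D Q}" by auto
      ultimately show ?thesis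
        using \<omega> w measurable_space[OF Z_P \<omega>] by (auto simp: sep'_def sep_def)
    qed
    show "\<omega> \<in> few neg"
    \<comment> \<open>Outside both \<open>few\<close> events,
      \<open>b \<bullet> \<beta> \<ge> 0\<close> would put the sample into \<open>sep' neg\<close>,
      and \<open>b \<bullet> \<beta> \<le> 0\<close> into \<open>sep' nonneg\<close>.\<close>
    proof (rule ccontr)
      assume "\<omega> \<notin> few neg"
      with in_sep[of neg] not_sep have "\<not> b \<bullet> \<beta> \<ge> 0"
        by (auto simp: neg_def mult_nonneg_nonpos)
      moreover from in_sep[of nonneg] not_sep not_few have "\<not> b \<bullet> \<beta> \<le> 0"
        by (auto simp: nonneg_def mult_nonpos_nonneg)
      ultimately show False by linarith
    qed
  qed

  \<comment> \<open>Union bound and the constant 3\<close>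
  have "separability_prob M X Y n \<le> M.prob ((few neg \<union> few nonneg) \<union> (sep' neg \<union> sep' nonneg))"
    unfolding separability_prob_def using sub neg nonneg by (intro M.finite_measure_mono) auto
  also have "\<dots> \<le> M.prob (few neg \<union> few nonneg) + M.prob (sep' neg \<union> sep' nonneg)"
    using neg nonneg by (intro measure_Un_le) auto
  also have "\<dots> \<le> (M.prob (few neg) + M.prob (few nonneg)) + (M.prob (sep' neg) + M.prob (sep' nonneg))"
    using neg nonneg by (intro add_mono measure_Un_le) auto
  also have "\<dots> \<le> 2 * exp (- t) + 2 * exp (- 8 * t)"
    using neg nonneg by linarith
  finally have bound: "separability_prob M X Y n \<le> 2 * exp (- t) + 2 * exp (- 8 * t)" .
  show ?thesis
  proof (cases "1 \<le> 3 * exp (- t)")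
    case True
    then show ?thesis
      unfolding separability_prob_def by (rule order_trans[OF M.prob_le_1])
  next
    case False
    \<comment> \<open>As \<open>exp (- t) < 1 / 3\<close> in this case, the smaller term is at most
      \<open>exp (- t) / 3\<close>, and the total is at most
      \<open>8 / 3 * exp (- t)\<close>.\<close>
    have "exp (- 8 * t) = exp (- 7 * t) * exp (- t)"
      by (simp flip: exp_add)
    also have "exp (- 7 * t) \<le> exp (- t)" using assms(11) by simp
    also have "exp (- t) * exp (- t) \<le> 1 / 3 * exp (- t)"
      using False by (intro mult_right_mono) auto
    finally have "exp (- 8 * t) \<le> 1 / 3 * exp (- t)" by simp
    moreover have "exp (- t) > 0" by simp
    ultimately show ?thesis using bound by linarith
  qed
qed

end
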